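(* For all $n\ge 3$, $\mathscr{Z}(C_n)=C_n$.
   Context: All graphs are finite, simple and undirected; equality of graphs here means isomorphism. $C_n$ denotes the cycle on $n$ vertices. Zero forcing: vertices of a graph $G$ are colored blue or white; the color change rule says that a blue vertex $u$ can change the color of a white vertex $w$ to blue if $w$ is the unique white neighbor of $u$. A set $B\subseteq V(G)$ is a zero forcing set of $G$ if, starting with exactly the vertices of $B$ blue and applying the color change rule repeatedly, all vertices eventually become blue. The zero forcing number $\operatorname{Z}(G)$ is the minimum of $|B|$ over all zero forcing sets $B$ of $G$; a minimum zero forcing set is a zero forcing set $B$ with $|B|=\operatorname{Z}(G)$. The zero forcing graph $\mathscr{Z}(G)$ is the graph whose vertices are the minimum zero forcing sets of $G$, with two of them adjacent if and only if their symmetric difference has exactly two elements. *)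

theory Defs
  imports "Graph_Theory.Pair_Digraph" "Graph_Theory.Digraph_Isomorphism"
begin

text \<open>
  A finite simple undirected graph is a \<^locale>\<open>pair_graph\<close>: its arc set is a symmetric,
  irreflexive relation on a finite vertex set, and an edge uv is the pair of arcs (u,v), (v,u).
  Isomorphism of graphs is \<^const>\<open>digraph_iso\<close>, applied through the coercion
  \<^const>\<open>with_proj\<close>; the lemma \<open>digraph_iso_pair_graph_iff\<close> below confirms that this is the
  usual notion.
\<close>

definition cycle_graph :: "nat \<Rightarrow> nat pair_pre_digraph" where
  "cycle_graph n = \<lparr> pverts = {0..<n},
     parcs = {(i, j). i < n \<and> j < n \<and> (j = (i + 1) mod n \<or> i = (j + 1) mod n)} \<rparr>"

text \<open>
  One application of the color change rule, where \<open>B\<close> and \<open>B'\<close> are the sets of blue vertices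
  before and after.
\<close>

definition color_change :: "'a pair_pre_digraph \<Rightarrow> 'a set \<Rightarrow> 'a set \<Rightarrow> bool" where
  "color_change G B B' \<longleftrightarrow>
     (\<exists>u\<in>B. \<exists>w. {x. (u, x) \<in> parcs G \<and> x \<notin> B} = {w} \<and> B' = insert w B)"

definition zero_forcing_set :: "'a pair_pre_digraph \<Rightarrow> 'a set \<Rightarrow> bool" where
  "zero_forcing_set G B \<longleftrightarrow> B \<subseteq> pverts G \<and> (color_change G)\<^sup>*\<^sup>* B (pverts G)"

definition zero_forcing_number :: "'a pair_pre_digraph \<Rightarrow> nat" where
  "zero_forcing_number G = (LEAST k. \<exists>B. zero_forcing_set G B \<and> card B = k)"

definition min_zero_forcing_set :: "'a pair_pre_digraph \<Rightarrow> 'a set \<Rightarrow> bool" where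
  "min_zero_forcing_set G B \<longleftrightarrow> zero_forcing_set G B \<and> card B = zero_forcing_number G"

definition zero_forcing_graph :: "'a pair_pre_digraph \<Rightarrow> 'a set pair_pre_digraph" where
  "zero_forcing_graph G = \<lparr> pverts = {B. min_zero_forcing_set G B},
     parcs = {(A, B). min_zero_forcing_set G A \<and> min_zero_forcing_set G B \<and>
                      card (sym_diff A B) = 2} \<rparr>"

lemma pair_graph_cycle_graph:
  assumes "n \<ge> 3"
  shows "pair_graph (cycle_graph n)"
proof -
  have fin: "finite (parcs (cycle_graph n))"
    by (rule finite_subset[of _ "{0..<n} \<times> {0..<n}"]) (auto simp: cycle_graph_def)
  have "i \<noteq> Suc i mod n" "Suc i mod n \<noteq> i" if "i < n" for i
    using that assms by (cases "Suc i = n"; auto)+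
  then show ?thesis using fin
    by unfold_locales
      (auto simp: cycle_graph_def arc_to_ends_def symmetric_def sym_def)
qed

lemma pair_graph_zero_forcing_graph:
  assumes "pair_graph G"
  shows "pair_graph (zero_forcing_graph G)"
proof -
  interpret pair_graph G by fact
  have V: "finite (pverts (zero_forcing_graph G))"
    by (rule finite_subset[of _ "Pow (pverts G)"])
      (auto simp: zero_forcing_graph_def min_zero_forcing_set_def zero_forcing_set_def)
  have A: "finite (parcs (zero_forcing_graph G))"
    by (rule finite_subset[OF _ finite_cartesian_product[OF V V]])
      (auto simp: zero_forcing_graph_def)
  show ?thesis using V A
    by unfold_locales
      (auto simp: zero_forcing_graph_def symmetric_def sym_def Un_commute)
qed

lemma digraph_iso_pair_graph_iff:
  fixes G :: "'a pair_pre_digraph" and H :: "'b pair_pre_digraph"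
  assumes "pair_graph G" "pair_graph H"
  shows "digraph_iso G H \<longleftrightarrow>
    (\<exists>f. bij_betw f (pverts G) (pverts H) \<and>
         (\<forall>u\<in>pverts G. \<forall>v\<in>pverts G. (u, v) \<in> parcs G \<longleftrightarrow> (f u, f v) \<in> parcs H))"
    (is "_ \<longleftrightarrow> ?R")
proof
  interpret G: pair_graph G by fact
  assume "digraph_iso G H"
  then obtain h where h: "pre_digraph.digraph_isomorphism G h" and H: "with_proj H = app_iso h G"
    unfolding digraph_iso_def by blast
  have ends: "iso_verts h (fst a) = iso_tail h (iso_arcs h a)"
              "iso_verts h (snd a) = iso_head h (iso_arcs h a)" if "a \<in> parcs G" for a
    using h that unfolding pre_digraph.digraph_isomorphism_def by auto
  have inj: "inj_on (iso_verts h) (pverts G)"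
    using h unfolding pre_digraph.digraph_isomorphism_def by auto
  have VH: "pverts H = iso_verts h ` pverts G" and AH: "parcs H = iso_arcs h ` parcs G"
    and th: "iso_tail h = fst" "iso_head h = snd"
    using arg_cong[OF H, of verts] arg_cong[OF H, of arcs]
      arg_cong[OF H, of tail] arg_cong[OF H, of head] by auto
  have arc: "iso_arcs h a = (iso_verts h (fst a), iso_verts h (snd a))" if "a \<in> parcs G" for a
    using ends[OF that] th by (simp add: prod_eq_iff)
  have "(u, v) \<in> parcs G \<longleftrightarrow> (iso_verts h u, iso_verts h v) \<in> parcs H"
    if uv: "u \<in> pverts G" "v \<in> pverts G" for u v
  proof
    assume "(u, v) \<in> parcs G"
    then show "(iso_verts h u, iso_verts h v) \<in> parcs H"
      using arc[of "(u, v)"] AH by force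
  next
    assume "(iso_verts h u, iso_verts h v) \<in> parcs H"
    then obtain x y where a: "(x, y) \<in> parcs G"
      and "(iso_verts h u, iso_verts h v) = iso_arcs h (x, y)"
      using AH by auto
    then have "iso_verts h u = iso_verts h x" "iso_verts h v = iso_verts h y"
      using arc[OF a] by auto
    with uv G.in_arcsD1[OF a] G.in_arcsD2[OF a] have "u = x" "v = y"
      using inj by (auto dest: inj_onD)
    with a show "(u, v) \<in> parcs G" by simp
  qed
  then show ?R using inj VH by (auto simp: bij_betw_def)
next
  interpret G: pair_graph G by fact
  interpret H: pair_graph H by fact
  assume ?R
  then obtain f where f: "bij_betw f (pverts G) (pverts H)"
    and adj: "\<And>u v. u \<in> pverts G \<Longrightarrow> v \<in> pverts G \<Longrightarrow>
                 (u, v) \<in> parcs G \<longleftrightarrow> (f u, f v) \<in> parcs H" by blast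
  let ?h = "\<lparr> iso_verts = f, iso_arcs = map_prod f f, iso_head = snd, iso_tail = fst \<rparr>"
  have inj: "inj_on f (pverts G)" and VH: "pverts H = f ` pverts G"
    using f by (auto simp: bij_betw_def)
  have "inj_on (map_prod f f) (parcs G)"
    by (rule inj_on_subset[OF map_prod_inj_on[OF inj inj]])
      (auto dest: G.in_arcsD1 G.in_arcsD2)
  then have iso: "pre_digraph.digraph_isomorphism G ?h"
    using inj G.wf_digraph by (auto simp: pre_digraph.digraph_isomorphism_def)
  have "parcs H = map_prod f f ` parcs G"
  proof (intro set_eqI iffI)
    fix a assume a: "a \<in> parcs H"
    obtain x y where xy: "a = (x, y)" by (cases a)
    with a have "x \<in> f ` pverts G" "y \<in> f ` pverts G"
      using H.in_arcsD1 H.in_arcsD2 VH by auto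
    then obtain u v where "u \<in> pverts G" "v \<in> pverts G" "x = f u" "y = f v" by blast
    with adj a xy show "a \<in> map_prod f f ` parcs G" by force
  next
    fix a assume "a \<in> map_prod f f ` parcs G"
    then show "a \<in> parcs H" using adj by (auto dest: G.in_arcsD1 G.in_arcsD2)
  qed
  then have "with_proj H = app_iso ?h G"
    using VH by (simp add: app_iso_def with_proj_def)
  with iso show "digraph_iso G H" unfolding digraph_iso_def by blast
qed

end

theory Submission
  imports Defs "HOL-Number_Theory.Cong"
begin

text \<open>
  A forcing vertex of a cycle has one white and hence one blue neighbour, so every proper zero
  forcing set contains two consecutive vertices. Conversely, from two consecutive vertices the
  blue arc grows around the cycle. Hence the minimum zero forcing sets are the pairs
  \<open>{i, i + 1}\<close>, and two of these differ in exactly two vertices iff they are consecutive.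
\<close>

lemma Suc_mod_inj_nat:
  fixes a b n :: nat
  shows "Suc a mod n = Suc b mod n \<longleftrightarrow> a mod n = b mod n"
  using cong_add_rcancel_nat[of a 1 b n] by (simp add: cong_def)

lemma add_mod_inj_nat:
  fixes i j k n :: nat
  assumes "j < n" "k < n"
  shows "(i + j) mod n = (i + k) mod n \<longleftrightarrow> j = k"
  using cong_add_lcancel_nat[of i j k n] assms by (simp add: cong_def)

text \<open>Translation by \<open>i\<close> is an injective self-map of a finite set, so counting
  makes it onto. This supplies predecessors without subtraction and shows that an arc of
  \<open>n\<close> successive vertices is the whole cycle.\<close>

lemma range_add_mod:
  fixes i n :: nat
  shows "(\<lambda>j. (i + j) mod n) ` {..<n} = {..<n}"
proof (rule card_subset_eq)
  show "card ((\<lambda>j. (i + j) mod n) ` {..<n}) = card {..<n}"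
    by (intro card_image inj_onI) (simp add: add_mod_inj_nat)
qed auto

text \<open>Centring at the successor of \<open>m\<close> names the preceding vertex
  \<open>m mod n\<close> and so avoids truncated subtraction at vertex 0.\<close>

lemma cycle_graph_nbrs:
  assumes "n > 0"
  shows "{x. (Suc m mod n, x) \<in> parcs (cycle_graph n)} = {m mod n, Suc (Suc m) mod n}"
proof -
  have "x = m mod n" if "x < n" "Suc m mod n = Suc x mod n" for x
    using that by (simp add: Suc_mod_inj_nat)
  then show ?thesis
    using assms by (auto simp: cycle_graph_def mod_simps)
qed

text \<open>The second inequality says that the two neighbours of a vertex are distinct; it fails
  for \<open>n = 2\<close>.\<close>

lemma Suc_mod_neq:
  fixes i n :: nat
  assumes "n \<ge> 3"
  shows "Suc i mod n \<noteq> i mod n" "Suc (Suc i) mod n \<noteq> i mod n"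
  using add_mod_inj_nat[of 1 n 0 i] add_mod_inj_nat[of 2 n 0 i] assms by auto

text \<open>Reducing both entries makes \<open>i = n - 1\<close> give the closing edge between
  \<open>n - 1\<close> and 0.\<close>

definition cycle_edge :: "nat \<Rightarrow> nat \<Rightarrow> nat set" where
  "cycle_edge n i = {i mod n, Suc i mod n}"

lemma card_cycle_edge:
  assumes "n \<ge> 3"
  shows "card (cycle_edge n i) = 2"
  using Suc_mod_neq(1)[OF assms, of i] by (simp add: cycle_edge_def)

lemma zero_forcing_set_cycle_contains_edge:
  assumes n: "n \<ge> 3" and zf: "zero_forcing_set (cycle_graph n) B"
  shows "\<exists>i<n. cycle_edge n i \<subseteq> B"
proof (cases "B = {..<n}")
  \<comment> \<open>If everything is blue at the start, no force need occur, so there is no forcing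
    vertex to examine.\<close>
  case True
  then show ?thesis
    using n by (intro exI[of _ 0]) (auto simp: cycle_edge_def)
next
  case False
  have B: "B \<subseteq> {..<n}" and "(color_change (cycle_graph n))\<^sup>*\<^sup>* B {..<n}"
    using zf by (auto simp: zero_forcing_set_def cycle_graph_def lessThan_atLeast0)
  then obtain B' where "color_change (cycle_graph n) B B'"
    using False by (meson converse_rtranclpE)
  then obtain u w where u: "u \<in> B"
    and w: "{x. (u, x) \<in> parcs (cycle_graph n) \<and> x \<notin> B} = {w}"
    unfolding color_change_def by blast
  have un: "u < n" using u B by auto
  \<comment> \<open>Surjectivity of the shift by 1 yields the predecessor \<open>m\<close> of the
    forcing vertex \<open>u\<close>.\<close>
  then have "u \<in> (\<lambda>j. (1 + j) mod n) ` {..<n}"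
    by (simp only: range_add_mod lessThan_iff)
  then obtain m where m: "m < n" and um: "u = Suc m mod n" by auto
  have "{x. (u, x) \<in> parcs (cycle_graph n)} = {m, Suc u mod n}"
    using cycle_graph_nbrs[of n m] n m um by (simp add: mod_simps)
  moreover have "m \<noteq> Suc u mod n"
    using Suc_mod_neq(2)[OF n, of m] m um by (simp add: mod_simps)
  moreover have "{x. (u, x) \<in> parcs (cycle_graph n)} - B = {w}"
    using w by blast
  \<comment> \<open>Of the two distinct neighbours of \<open>u\<close> only \<open>w\<close> is
    white, so the other one is blue.\<close>
  ultimately have "m \<in> B \<or> Suc u mod n \<in> B"
    by (metis Diff_iff insertCI singletonD)
  then have "cycle_edge n m \<subseteq> B \<or> cycle_edge n u \<subseteq> B"
    using u un m um by (auto simp: cycle_edge_def)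
  then show ?thesis
    using un m by blast
qed

lemma zero_forcing_set_cycle_edge:
  assumes n: "n \<ge> 3"
  shows "zero_forcing_set (cycle_graph n) (cycle_edge n i)"
proof -
  \<comment> \<open>\<open>P k\<close> is the arc of the \<open>k\<close> vertices from
    \<open>i\<close> onwards. Its last vertex has a blue predecessor and hence forces the next
    vertex along the cycle.\<close>
  define P where "P k = (\<lambda>j. (i + j) mod n) ` {..<k}" for k
  have "color_change (cycle_graph n) (P (Suc (Suc k))) (P (Suc (Suc (Suc k))))"
    if k: "Suc (Suc k) < n" for k
  proof -
    let ?B = "P (Suc (Suc k))" and ?w = "(i + Suc (Suc k)) mod n"
    have u: "(i + k) mod n \<in> ?B" "Suc (i + k) mod n \<in> ?B"
      unfolding P_def by (simp, simp add: image_iff lessThan_Suc)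
    \<comment> \<open>Since \<open>k + 2 < n\<close>, the arc has not yet closed up: the offset
      \<open>k + 2\<close> differs modulo \<open>n\<close> from all smaller ones.\<close>
    have w: "?w \<notin> ?B"
      using k add_mod_inj_nat[of "Suc (Suc k)" n _ i] unfolding P_def by fastforce
    have "{x. (Suc (i + k) mod n, x) \<in> parcs (cycle_graph n)} = {(i + k) mod n, ?w}"
      using cycle_graph_nbrs[of n "i + k"] n by simp
    then have "{x. (Suc (i + k) mod n, x) \<in> parcs (cycle_graph n)} - ?B = {?w}"
      using u(1) w by (simp only: insert_Diff_if if_True if_False empty_Diff)
    then have "{x. (Suc (i + k) mod n, x) \<in> parcs (cycle_graph n) \<and> x \<notin> ?B} = {?w}"
      by (simp only: set_diff_eq mem_Collect_eq)
    moreover have "P (Suc (Suc (Suc k))) = insert ?w ?B"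
      unfolding P_def by (simp only: lessThan_Suc image_insert)
    ultimately show ?thesis
      unfolding color_change_def using u(2) by blast
  qed
  then have "(color_change (cycle_graph n))\<^sup>*\<^sup>* (P 2) (P (Suc (Suc k)))"
    if "Suc (Suc k) \<le> n" for k
    using that
    by (induction k) (auto simp: numeral_2_eq_2 intro: rtranclp.rtrancl_into_rtrancl)
  from this[of "n - 2"] have "(color_change (cycle_graph n))\<^sup>*\<^sup>* (P 2) (P n)"
    using n by (simp add: numeral_2_eq_2 Suc_diff_Suc)
  moreover have "P 2 = cycle_edge n i"
    by (auto simp: P_def cycle_edge_def numeral_2_eq_2 lessThan_Suc)
  moreover have "P n = {0..<n}"
    unfolding P_def range_add_mod by (rule lessThan_atLeast0)
  ultimately show ?thesis
    using n by (auto simp: zero_forcing_set_def cycle_graph_def cycle_edge_def)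
qed

lemma card_zero_forcing_set_cycle:
  assumes "n \<ge> 3" "zero_forcing_set (cycle_graph n) B"
  shows "card B \<ge> 2"
proof -
  have "finite B"
    using assms(2) by (auto simp: zero_forcing_set_def cycle_graph_def intro: finite_subset)
  then show ?thesis
    using zero_forcing_set_cycle_contains_edge[OF assms] card_mono card_cycle_edge[OF assms(1)]
    by metis
qed

lemma zero_forcing_number_cycle:
  assumes "n \<ge> 3"
  shows "zero_forcing_number (cycle_graph n) = 2"
  unfolding zero_forcing_number_def
  using assms zero_forcing_set_cycle_edge card_cycle_edge card_zero_forcing_set_cycle
  by (intro Least_equality) blast+

lemma min_zero_forcing_sets_cycle:
  assumes n: "n \<ge> 3"
  shows "{B. min_zero_forcing_set (cycle_graph n) B} = cycle_edge n ` {..<n}"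
proof -
  have "B \<in> cycle_edge n ` {..<n}"
    if B: "zero_forcing_set (cycle_graph n) B" "card B = 2" for B
  proof -
    obtain i where "i < n" "cycle_edge n i \<subseteq> B"
      using zero_forcing_set_cycle_contains_edge[OF n B(1)] by blast
    moreover have "finite B" using B(2) by (auto intro: card_ge_0_finite)
    ultimately show ?thesis
      using card_subset_eq[of B "cycle_edge n i"] card_cycle_edge[OF n] B(2) by auto
  qed
  then show ?thesis
    using n by (auto simp: min_zero_forcing_set_def zero_forcing_number_cycle
        card_cycle_edge zero_forcing_set_cycle_edge)
qed

text \<open>Equal pairs agree either entrywise or crosswise, and a crosswise match would make
  \<open>j\<close> its own second successor.\<close>

lemma inj_on_cycle_edge:
  assumes n: "n \<ge> 3"
  shows "inj_on (cycle_edge n) {..<n}"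
proof (rule inj_onI)
  fix i j assume ij: "i \<in> {..<n}" "j \<in> {..<n}" "cycle_edge n i = cycle_edge n j"
  then consider "i = j" | "i = Suc j mod n" "j = Suc i mod n"
    unfolding cycle_edge_def doubleton_eq_iff by (metis lessThan_iff mod_less)
  then show "i = j"
  proof cases
    case 2
    then have "Suc (Suc j) mod n = j mod n" using ij(2) by (metis lessThan_iff mod_less mod_Suc_eq)
    then show ?thesis using Suc_mod_neq(2)[OF n] by blast
  qed
qed

text \<open>Consecutive edges share one vertex and leave their two outer ends, which are distinct
  for \<open>n\<close> \<ge> 3. Equal edges leave nothing, and all other pairs are disjoint and
  leave four vertices.\<close>

lemma card_sym_diff_cycle_edges:
  assumes n: "n \<ge> 3" and ij: "i < n" "j < n"
  shows "card (sym_diff (cycle_edge n i) (cycle_edge n j)) = 2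
    \<longleftrightarrow> j = Suc i mod n \<or> i = Suc j mod n"
proof -
  have neq: "Suc k mod n \<noteq> k" "Suc (Suc k mod n) mod n \<noteq> k" if "k < n" for k
    using Suc_mod_neq[OF n, of k] that by (simp_all add: mod_simps)
  have consecutive: "card (sym_diff (cycle_edge n k) (cycle_edge n (Suc k mod n))) = 2"
    if k: "k < n" for k
  proof -
    let ?l = "Suc k mod n" and ?m = "Suc (Suc k mod n) mod n"
    have "?l < n" using n by simp
    then have "sym_diff (cycle_edge n k) (cycle_edge n ?l) = {k, ?m}"
      using neq[OF k] neq(1)[of ?l] k unfolding cycle_edge_def by auto
    then show ?thesis using neq(2)[OF k] by simp
  qed
  consider "i = j" | "j = Suc i mod n" | "i = Suc j mod n"
    | "i \<noteq> j" "j \<noteq> Suc i mod n" "i \<noteq> Suc j mod n" by blast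
  then show ?thesis
  proof cases
    case 1
    then show ?thesis using neq(1)[OF ij(1)] by auto
  next
    case 2
    then show ?thesis using consecutive[OF ij(1)] by simp
  next
    case 3
    then show ?thesis using consecutive[OF ij(2)] by (simp add: Un_commute)
  next
    case 4
    then have "Suc i mod n \<noteq> Suc j mod n" using ij by (simp add: Suc_mod_inj_nat)
    with 4 have "cycle_edge n i \<inter> cycle_edge n j = {}"
      using ij by (auto simp: cycle_edge_def)
    then have "sym_diff (cycle_edge n i) (cycle_edge n j) = cycle_edge n i \<union> cycle_edge n j"
      by blast
    moreover have "card (cycle_edge n i \<union> cycle_edge n j) = 4"
      using \<open>cycle_edge n i \<inter> cycle_edge n j = {}\<close> card_cycle_edge[OF n]
      by (subst card_Un_disjoint) (auto simp: cycle_edge_def)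
    ultimately show ?thesis using 4 by simp
  qed
qed

theorem proposition2p2:
  fixes n :: nat
  assumes "n \<ge> 3"
  shows "digraph_iso (zero_forcing_graph (cycle_graph n)) (cycle_graph n)"
proof -
  let ?C = "cycle_graph n" and ?e = "cycle_edge n"
  let ?Z = "zero_forcing_graph ?C" and ?f = "the_inv_into {..<n} ?e"
  have inj: "inj_on ?e {..<n}" using inj_on_cycle_edge[OF assms] .
  have Z: "pverts ?Z = ?e ` {..<n}"
    using min_zero_forcing_sets_cycle[OF assms] by (simp add: zero_forcing_graph_def)
  \<comment> \<open>The isomorphism sends each minimum zero forcing set, an edge of the cycle, to
    the vertex at which that edge starts; injectivity of \<open>cycle_edge n\<close> makes this
    vertex unique.\<close>
  have "bij_betw ?f (pverts ?Z) (pverts ?C)"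
    using inj bij_betw_the_inv_into[of ?e "{..<n}" "?e ` {..<n}"] unfolding Z
    by (simp add: bij_betw_def cycle_graph_def lessThan_atLeast0)
  moreover have "(A, B) \<in> parcs ?Z \<longleftrightarrow> (?f A, ?f B) \<in> parcs ?C"
    if AB: "A \<in> pverts ?Z" "B \<in> pverts ?Z" for A B
  proof -
    obtain i j where ij: "i < n" "j < n" "A = ?e i" "B = ?e j"
      using AB unfolding Z by auto
    have "(A, B) \<in> parcs ?Z \<longleftrightarrow> card (sym_diff A B) = 2"
      using AB by (simp add: zero_forcing_graph_def)
    also have "\<dots> \<longleftrightarrow> (i, j) \<in> parcs ?C"
      using card_sym_diff_cycle_edges[OF assms ij(1,2)] ij by (simp add: cycle_graph_def)
    finally show ?thesis using ij inj by (simp add: the_inv_into_f_f)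
  qed
  ultimately show ?thesis
    using digraph_iso_pair_graph_iff pair_graph_cycle_graph[OF assms]
      pair_graph_zero_forcing_graph by blast
qed

end
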